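(* Assume the Continuum Hypothesis. For every point $x$ of $\omega^* = \beta\omega\setminus\omega$, the space $\omega^* \setminus \{x\}$ has arbitrarily large finite compactifications; that is, for every $n \in \mathbb{N}$ there is a finite compactification of $\omega^* \setminus \{x\}$ whose remainder has at least $n$ points.
   Context: $\omega^* = \beta\omega\setminus\omega$ is the Stone-Čech remainder of the countable discrete space $\omega$. A finite compactification of a space $Y$ is a compact Hausdorff space $Z$ containing $Y$ as a dense subspace such that the remainder $Z \setminus Y$ is finite. *)

theory Defs
  imports "HOL-Analysis.Analysis"
begin

unbundle cardinal_syntax

section \<open>The Continuum Hypothesis\<close>

definition continuum_hypothesis :: bool where
  "continuum_hypothesis \<longleftrightarrow> |UNIV :: nat set set| =o cardSuc natLeq"

section \<open>The Stone-Cech compactification of the discrete space of natural numbers\<close>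

definition ultrafilter :: "'a filter \<Rightarrow> bool" where
  "ultrafilter F \<longleftrightarrow>
     F \<noteq> bot \<and> (\<forall>A. eventually (\<lambda>n. n \<in> A) F \<or> eventually (\<lambda>n. n \<notin> A) F)"

definition beta_omega :: "nat filter topology" where
  "beta_omega = topology_generated_by
     (range (\<lambda>A. {F. ultrafilter F \<and> eventually (\<lambda>n. n \<in> A) F}))"

text \<open>The natural number \<open>n\<close> is identified with the principal ultrafilter at \<open>n\<close>.\<close>

definition omega_in_beta :: "nat filter set" where
  "omega_in_beta = range (\<lambda>n. principal {n})"

definition omega_star :: "nat filter topology" where
  "omega_star = subtopology beta_omega (topspace beta_omega - omega_in_beta)"

section \<open>Finite compactifications\<close>

text \<open>\<open>Y\<close> is literally a subspace of \<open>Z\<close>, so the remainder has to consist of elements of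
  \<open>'a\<close> outside \<open>topspace Y\<close>. This is no restriction when that complement is infinite, as it
  is for spaces of ultrafilters in type \<open>nat filter\<close>.\<close>

definition finite_compactification :: "'a topology \<Rightarrow> 'a topology \<Rightarrow> bool" where
  "finite_compactification Z Y \<longleftrightarrow>
     compact_space Z \<and> Hausdorff_space Z \<and>
     topspace Y \<subseteq> topspace Z \<and> subtopology Z (topspace Y) = Y \<and>
     Z closure_of topspace Y = topspace Z \<and>
     finite (topspace Z - topspace Y)"

section \<open>The ultrafilter model has the defining properties of the Stone-Cech compactification\<close>

lemma topspace_beta_omega: "topspace beta_omega = {F. ultrafilter F}"
  unfolding beta_omega_def topology_generated_by_topspace
  by (auto intro!: exI[of _ UNIV])

lemma ultrafilter_not:
  assumes "ultrafilter F"
  shows "eventually (\<lambda>n. \<not> P n) F \<longleftrightarrow> \<not> eventually P F"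
proof -
  have "eventually P F \<or> eventually (\<lambda>n. \<not> P n) F"
    using assms[unfolded ultrafilter_def, THEN conjunct2, rule_format, of "Collect P"] by simp
  moreover have False if "eventually P F" "eventually (\<lambda>n. \<not> P n) F"
  proof -
    from that have "eventually (\<lambda>n. False) F" by eventually_elim simp
    then show False using assms by (simp add: ultrafilter_def eventually_False)
  qed
  ultimately show ?thesis by blast
qed

lemma ultrafilter_principal_singleton: "ultrafilter (principal {n})"
  unfolding ultrafilter_def by (auto simp: eventually_principal principal_eq_bot_iff)

lemma ultrafilter_refines:
  assumes "F \<noteq> bot"
  obtains U where "ultrafilter U" "U \<le> F"
proof -
  let ?S = "{G. G \<noteq> bot \<and> G \<le> F}"
  have "\<exists>U\<in>?S. \<forall>G\<in>?S. G \<le> U \<longrightarrow> G = U"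
  proof (rule predicate_Zorn[of ?S "\<lambda>a b. b \<le> a"])
    show "partial_order_on ?S (relation_of (\<lambda>a b. b \<le> a) ?S)"
      by (rule partial_order_on_relation_ofI) auto
    fix C assume C: "C \<in> Chains (relation_of (\<lambda>a b. b \<le> a) ?S)"
    then have sub: "C \<subseteq> ?S" and tot: "\<And>a b. a \<in> C \<Longrightarrow> b \<in> C \<Longrightarrow> a \<le> b \<or> b \<le> a"
      by (auto simp: Chains_def relation_of_def)
    show "\<exists>u\<in>?S. \<forall>a\<in>C. u \<le> a"
    proof (cases "C = {}")
      case True
      then show ?thesis using assms by auto
    next
      case False
      have "eventually P (Inf C) \<longleftrightarrow> (\<exists>b\<in>C. eventually P b)" for P
       
      proof (rule eventually_Inf_base[OF False])
        fix a b assume "a \<in> C" "b \<in> C"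
        with tot[OF this] show "\<exists>x\<in>C. x \<le> inf a b" by auto
      qed
      from this[of "\<lambda>_. False"] have "Inf C \<noteq> bot"
        using sub by (auto simp: eventually_False)
      moreover have "Inf C \<le> F"
      proof -
        obtain G where "G \<in> C" using False by blast
        moreover from this have "G \<le> F" using sub by blast
        ultimately show ?thesis by (rule Inf_lower2)
      qed
      ultimately show ?thesis by (auto intro: Inf_lower)
    qed
  qed
  then obtain U where U: "U \<noteq> bot" "U \<le> F"
    and min: "\<And>G. G \<noteq> bot \<Longrightarrow> G \<le> F \<Longrightarrow> G \<le> U \<Longrightarrow> G = U" by auto
  have "ultrafilter U"
    unfolding ultrafilter_def
  proof (intro conjI allI U(1))
    fix A
    show "eventually (\<lambda>n. n \<in> A) U \<or> eventually (\<lambda>n. n \<notin> A) U"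
    proof (cases "inf U (principal A) = bot")
      case True
      then have "eventually (\<lambda>n. False) (inf U (principal A))" by simp
      then show ?thesis by (simp add: eventually_inf_principal)
    next
      case False
      then have "inf U (principal A) = U"
        using U(2) by (intro min) (auto intro: le_infI1)
      moreover have "eventually (\<lambda>n. n \<in> A) (inf U (principal A))"
        by (simp add: eventually_inf_principal)
      ultimately show ?thesis by simp
    qed
  qed
  with U that show thesis by blast
qed

lemma openin_beta_omega_basic:
  "openin beta_omega {F. ultrafilter F \<and> eventually P F}"
  unfolding beta_omega_def
  by (rule topology_generated_by_Basis, rule range_eqI[where x = "Collect P"]) simp

lemma openin_beta_omega:
  "openin beta_omega W \<longleftrightarrow>
     W \<subseteq> {F. ultrafilter F} \<and>
     (\<forall>F\<in>W. \<exists>A. eventually (\<lambda>n. n \<in> A) F \<and>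
        {G. ultrafilter G \<and> eventually (\<lambda>n. n \<in> A) G} \<subseteq> W)" (is "_ \<longleftrightarrow> ?R W")
proof
  assume "openin beta_omega W"
  then have "generate_topology_on
      (range (\<lambda>A. {F. ultrafilter F \<and> eventually (\<lambda>n. n \<in> A) F})) W"
    by (simp add: beta_omega_def openin_topology_generated_by_iff)
  then show "?R W"
  proof induction
    case (Int a b)
    have "\<exists>A. eventually (\<lambda>n. n \<in> A) F \<and>
        {G. ultrafilter G \<and> eventually (\<lambda>n. n \<in> A) G} \<subseteq> a \<inter> b" if "F \<in> a \<inter> b" for F
    proof -
      obtain A B where "eventually (\<lambda>n. n \<in> A) F" "eventually (\<lambda>n. n \<in> B) F"
        "{G. ultrafilter G \<and> eventually (\<lambda>n. n \<in> A) G} \<subseteq> a"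
        "{G. ultrafilter G \<and> eventually (\<lambda>n. n \<in> B) G} \<subseteq> b"
        using Int \<open>F \<in> a \<inter> b\<close> by blast
      then show ?thesis
        by (intro exI[of _ "A \<inter> B"]) (auto simp: eventually_conj_iff)
    qed
    with Int show ?case by blast
  next
    case (UN K)
    show ?case
    proof (intro conjI ballI)
      show "\<Union>K \<subseteq> {F. ultrafilter F}" using UN by blast
      fix F assume "F \<in> \<Union>K"
      then obtain k where "k \<in> K" "F \<in> k" by blast
      with UN obtain A where "eventually (\<lambda>n. n \<in> A) F"
        "{G. ultrafilter G \<and> eventually (\<lambda>n. n \<in> A) G} \<subseteq> k" by blast
      with \<open>k \<in> K\<close> show "\<exists>A. eventually (\<lambda>n. n \<in> A) F \<and>
          {G. ultrafilter G \<and> eventually (\<lambda>n. n \<in> A) G} \<subseteq> \<Union>K" by blast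
    qed
  next
    case (Basis s)
    then show ?case by auto
  qed simp
next
  assume R: "?R W"
  show "openin beta_omega W"
    unfolding openin_subopen[of _ W]
  proof
    fix F assume "F \<in> W"
    with R obtain A where "ultrafilter F" "eventually (\<lambda>n. n \<in> A) F"
        "{G. ultrafilter G \<and> eventually (\<lambda>n. n \<in> A) G} \<subseteq> W"
      by blast
    then show "\<exists>T. openin beta_omega T \<and> F \<in> T \<and> T \<subseteq> W"
      using openin_beta_omega_basic[of "\<lambda>n. n \<in> A"] by blast
  qed
qed

lemma Hausdorff_space_beta_omega: "Hausdorff_space beta_omega"
  unfolding Hausdorff_space_def
proof (intro allI impI)
  fix F G assume "F \<in> topspace beta_omega \<and> G \<in> topspace beta_omega \<and> F \<noteq> G"
  then have u: "ultrafilter F" "ultrafilter G" and "F \<noteq> G"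
    by (auto simp: topspace_beta_omega)
  then obtain P where "eventually P F \<noteq> eventually P G"
    by (auto simp: filter_eq_iff)
  then obtain Q where Q: "eventually Q F" "eventually (\<lambda>n. \<not> Q n) G"
    using ultrafilter_not[OF u(1)] ultrafilter_not[OF u(2)] by (metis (no_types, lifting))
  have "disjnt {H. ultrafilter H \<and> eventually Q H} {H. ultrafilter H \<and> eventually (\<lambda>n. \<not> Q n) H}"
    by (auto simp: disjnt_def ultrafilter_not)
  then show "\<exists>U V. openin beta_omega U \<and> openin beta_omega V \<and> F \<in> U \<and> G \<in> V \<and> disjnt U V"
    using Q u openin_beta_omega_basic by blast
qed

lemma compact_space_beta_omega: "compact_space beta_omega"
proof -
  let ?b = "\<lambda>A. {F. ultrafilter F \<and> eventually (\<lambda>n. n \<in> A) F}"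
  have "\<exists>\<F>. finite \<F> \<and> \<F> \<subseteq> \<U> \<and> topspace beta_omega \<subseteq> \<Union>\<F>"
    if op: "\<And>U. U \<in> \<U> \<Longrightarrow> openin beta_omega U" and cov: "topspace beta_omega \<subseteq> \<Union>\<U>" for \<U>
  proof -
    define \<A> where "\<A> = {A. \<exists>U\<in>\<U>. ?b A \<subseteq> U}"
    let ?N = "INF A\<in>\<A>. principal (- A)"
    have "?N = bot"
    proof (rule ccontr)
      assume "?N \<noteq> bot"
      then obtain F where F: "ultrafilter F" "F \<le> ?N" by (rule ultrafilter_refines)
      then obtain U where "U \<in> \<U>" "F \<in> U" using cov by (auto simp: topspace_beta_omega)
      then obtain A where A: "eventually (\<lambda>n. n \<in> A) F" "?b A \<subseteq> U"
        using op[of U] by (auto simp: openin_beta_omega)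
      with \<open>U \<in> \<U>\<close> have "A \<in> \<A>" by (auto simp: \<A>_def)
      then have "F \<le> principal (- A)" using F(2) by (meson INF_lower order_trans)
      then have "eventually (\<lambda>n. n \<notin> A) F" by (simp add: le_principal)
      with A F show False by (simp add: ultrafilter_not)
    qed
    then have "eventually (\<lambda>n. False) ?N" by simp
    from this[THEN eventually_INF[THEN iffD1]] obtain X where X: "X \<subseteq> \<A>" "finite X"
      and ev: "eventually (\<lambda>n. False) (INF A\<in>X. principal (- A))"
      by blast
    then have "\<forall>A\<in>X. \<exists>U. U \<in> \<U> \<and> ?b A \<subseteq> U"
      unfolding \<A>_def by blast
    from bchoice[OF this] obtain u where u: "\<And>A. A \<in> X \<Longrightarrow> u A \<in> \<U> \<and> ?b A \<subseteq> u A"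
      by blast
    have "topspace beta_omega \<subseteq> \<Union>(u ` X)"
    proof
      fix F assume "F \<in> topspace beta_omega"
      then have F: "ultrafilter F" by (simp add: topspace_beta_omega)
      have "\<exists>A\<in>X. eventually (\<lambda>n. n \<in> A) F"
      proof (rule ccontr)
        assume "\<not> ?thesis"
        then have "F \<le> (INF A\<in>X. principal (- A))"
          using F by (auto intro!: INF_greatest simp: le_principal ultrafilter_not)
        with ev have "eventually (\<lambda>n. False) F" by (simp add: filter_leD)
        with F show False by (simp add: ultrafilter_def eventually_False)
      qed
      with F u show "F \<in> \<Union>(u ` X)" by blast
    qed
    with X u show ?thesis by (intro exI[of _ "u ` X"]) auto
  qed
  then show ?thesis unfolding compact_space_alt by auto
qed

lemma openin_beta_omega_singleton: "openin beta_omega {principal {n}}"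
proof -
  have "F = principal {n}" if "ultrafilter F" "eventually (\<lambda>m. m = n) F" for F
  proof -
    have "F \<le> principal {n}" unfolding le_principal using that(2) by simp
    moreover have "principal {n} \<le> F"
    proof (rule filter_leI)
      fix P assume "eventually P F"
      with that(2) have "eventually (\<lambda>m. P n) F" by eventually_elim simp
      moreover have "F \<noteq> bot" using that(1) unfolding ultrafilter_def by blast
      ultimately have "P n" by (simp add: eventually_const)
      then show "eventually P (principal {n})" by (simp add: eventually_principal)
    qed
    ultimately show ?thesis by (rule antisym)
  qed
  moreover have "eventually (\<lambda>m. m = n) (principal {n})"
    by (simp add: eventually_principal)
  ultimately have "{F. ultrafilter F \<and> eventually (\<lambda>m. m = n) F} = {principal {n}}"
    using ultrafilter_principal_singleton[of n] by blast
  with openin_beta_omega_basic[of "\<lambda>m. m = n"] show ?thesis by simp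
qed

lemma dense_omega_in_beta: "beta_omega closure_of omega_in_beta = topspace beta_omega"
proof -
  have *: "\<exists>y\<in>omega_in_beta. y \<in> T" if T: "openin beta_omega T" "F \<in> T" for F T
  proof -
    obtain A where A: "ultrafilter F" "eventually (\<lambda>n. n \<in> A) F"
        "{G. ultrafilter G \<and> eventually (\<lambda>n. n \<in> A) G} \<subseteq> T"
      using T unfolding openin_beta_omega by blast
    have "F \<noteq> bot" using A(1) unfolding ultrafilter_def by blast
    with A(2) obtain n where "n \<in> A"
      using eventually_happens'[of F "\<lambda>n. n \<in> A"] by blast
    then show ?thesis
      using A(3) ultrafilter_principal_singleton[of n]
      by (intro bexI[of _ "principal {n}"]) (auto simp: omega_in_beta_def eventually_principal)
  qed
  have "topspace beta_omega \<subseteq> beta_omega closure_of omega_in_beta"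
  proof
    fix F assume F: "F \<in> topspace beta_omega"
    show "F \<in> beta_omega closure_of omega_in_beta"
      unfolding in_closure_of using F * by metis
  qed
  then show ?thesis by (intro equalityI closure_of_subset_topspace)
qed

theorem beta_omega_extension:
  fixes K :: "'b topology" and f :: "nat \<Rightarrow> 'b"
  assumes K: "compact_space K" "Hausdorff_space K" and f: "range f \<subseteq> topspace K"
  obtains g where "continuous_map beta_omega K g" "\<And>n. g (principal {n}) = f n"
proof -
  have ex: "\<exists>l. limitin K f l F" if F: "ultrafilter F" for F
  proof (rule ccontr)
    assume "\<not> ?thesis"
    then have "\<forall>l\<in>topspace K. \<exists>U. openin K U \<and> l \<in> U \<and> \<not> eventually (\<lambda>n. f n \<in> U) F"
      by (auto simp: limitin_def)
    then obtain U where U: "\<And>l. l \<in> topspace K \<Longrightarrow>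
        openin K (U l) \<and> l \<in> U l \<and> \<not> eventually (\<lambda>n. f n \<in> U l) F"
      by metis
    then obtain \<F> where \<F>: "finite \<F>" "\<F> \<subseteq> U ` topspace K" "topspace K \<subseteq> \<Union>\<F>"
      using K(1)[unfolded compact_space_alt, rule_format, of "U ` topspace K"] by blast
    have "eventually (\<lambda>n. \<forall>V\<in>\<F>. f n \<notin> V) F"
      using \<F> U F by (subst eventually_ball_finite_distrib) (auto simp: ultrafilter_not)
    then have "eventually (\<lambda>n. False) F"
      by (rule eventually_mono) (use f \<F>(3) in blast)
    with F show False by (simp add: ultrafilter_def eventually_False)
  qed
  define g where "g F = (SOME l. limitin K f l F)" for F
  have g: "limitin K f (g F) F" if "ultrafilter F" for F
    unfolding g_def using ex[OF that] by (rule someI_ex)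
  have reg: "regular_space K"
    using K by (simp add: compact_Hausdorff_imp_regular_space)
  have "continuous_map beta_omega K g"
    unfolding continuous_map_atin
  proof
    fix F assume "F \<in> topspace beta_omega"
    then have F: "ultrafilter F" by (simp add: topspace_beta_omega)
    show "limitin K g (g F) (atin beta_omega F)"
      unfolding limitin_def
    proof (intro conjI allI impI)
      show "g F \<in> topspace K" using g[OF F] by (simp add: limitin_def)
      fix W assume W: "openin K W \<and> g F \<in> W"
      then obtain U V where UV: "openin K U" "closedin K V" "g F \<in> U" "U \<subseteq> V" "V \<subseteq> W"
        using reg[unfolded neighbourhood_base_of_closedin[symmetric] neighbourhood_base_of]
        by metis
      then have ev: "eventually (\<lambda>n. f n \<in> U) F" using g[OF F] by (auto simp: limitin_def)
      have "g G \<in> W" if G: "ultrafilter G" "eventually (\<lambda>n. f n \<in> U) G" for G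
      proof (rule ccontr)
        assume "g G \<notin> W"
        then have "g G \<in> topspace K - V" "openin K (topspace K - V)"
          using UV g[OF G(1)] by (auto simp: limitin_def)
        then have "eventually (\<lambda>n. f n \<in> topspace K - V) G"
          using g[OF G(1)] by (auto simp: limitin_def)
        with G(2) have "eventually (\<lambda>n. False) G"
          by eventually_elim (use UV in blast)
        with G show False by (simp add: ultrafilter_def eventually_False)
      qed
      then show "eventually (\<lambda>G. g G \<in> W) (atin beta_omega F)"
        unfolding eventually_atin
        using F ev openin_beta_omega_basic[of "\<lambda>n. f n \<in> U"] by blast
    qed
  qed
  moreover have "g (principal {n}) = f n" for n
  proof (rule limitin_Hausdorff_unique[OF g _ _ K(2)])
    show "limitin K f (f n) (principal {n})"
      using f by (auto simp: limitin_def eventually_principal)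
  qed (auto simp: ultrafilter_principal_singleton principal_eq_bot_iff)
  ultimately show thesis using that by blast
qed

end

theory Submission
  imports Defs "HOL-Library.Countable_Set_Type"
begin

text \<open>A topological space minus a point, split into finitely many disjoint open sets each
  accumulating at that point, is compactified by giving each piece its own copy of the point.
  Such a splitting of \<open>\<omega>\<^sup>* - {x}\<close> is coded by partial \<open>n\<close>-colourings of \<open>\<nat>\<close>, one for each
  member \<open>A\<close> of the ultrafilter \<open>x\<close>, which are total off \<open>A\<close>, undefined \<open>x\<close>-almost everywhere,
  use every colour infinitely often on \<open>A\<close>, and pairwise disagree only finitely often. Under CH the
  members of \<open>x\<close> can be well-ordered with countable initial segments, so the colourings can be
  chosen recursively: off \<open>A\<close>, copy the first colouring (in an \<open>\<omega>\<close>-enumeration of the earlier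
  ones) that is defined; on \<open>A\<close>, colour freely a pseudo-intersection of
  \<open>A\<close> and the sets where the earlier colourings are undefined.\<close>

section \<open>Splitting a point\<close>

text \<open>Near its copy \<open>q i\<close>, the new space looks like \<open>X\<close> near
  \<open>x\<close> restricted to \<open>U i\<close>. Disjointness of the pieces separates the
  copies, accumulation of \<open>U i\<close> at \<open>x\<close> keeps \<open>q i\<close> from being
  isolated, and compactness survives because finitely many neighbourhoods of \<open>x\<close> have a
  common one. The map \<open>q\<close> supplies names for the copies outside
  \<open>X\<close>.\<close>

lemma finite_compactification_split_point:
  fixes X :: "'a topology" and I :: "'i set"
  assumes X: "compact_space X" "Hausdorff_space X" and x: "x \<in> topspace X"
    and I: "finite I" and q: "inj_on q I" "\<And>i. i \<in> I \<Longrightarrow> q i \<notin> topspace X"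
    and U: "\<And>i. i \<in> I \<Longrightarrow> openin X (U i)" "disjoint_family_on U I"
      "(\<Union>i\<in>I. U i) = topspace X - {x}"
    and cl: "\<And>i. i \<in> I \<Longrightarrow> x \<in> X closure_of U i"
  obtains Z where "finite_compactification Z (subtopology X (topspace X - {x}))"
    "topspace Z - (topspace X - {x}) = q ` I"
proof -
  define Y where "Y = topspace X - {x}"
  have Yo: "openin X Y"
    unfolding Y_def using U(1,3) by (metis openin_Union imageE)
  have UY: "U i \<subseteq> Y" if "i \<in> I" for i
    using U(3) that by (auto simp: Y_def)
  have qY: "q i \<notin> Y" if "i \<in> I" for i
    using q(2)[OF that] by (auto simp: Y_def)
  \<comment> \<open>Old points keep their neighbourhoods; \<open>q i\<close> inherits the traces on
    \<open>U i\<close> of the neighbourhoods of \<open>x\<close>.\<close>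
  define op where "op W \<longleftrightarrow> W \<subseteq> Y \<union> q ` I \<and> openin X (W \<inter> Y) \<and>
      (\<forall>i\<in>I. q i \<in> W \<longrightarrow> (\<exists>V. openin X V \<and> x \<in> V \<and> V \<inter> U i \<subseteq> W))" for W
  have opD: "\<exists>V. openin X V \<and> x \<in> V \<and> V \<inter> U i \<subseteq> W" if "op W" "i \<in> I" "q i \<in> W" for W i
    using that by (simp add: op_def)
  have "istopology op"
    unfolding istopology_def
  proof (intro conjI allI impI)
    fix S T assume S: "op S" and T: "op T"
    have "openin X (S \<inter> T \<inter> Y)"
      using openin_Int[of X "S \<inter> Y" "T \<inter> Y"] S T
      by (simp add: op_def Int_ac)
    moreover have "\<exists>V. openin X V \<and> x \<in> V \<and> V \<inter> U i \<subseteq> S \<inter> T"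
      if i: "i \<in> I" "q i \<in> S \<inter> T" for i
    proof -
      obtain V where "openin X V" "x \<in> V" "V \<inter> U i \<subseteq> S"
        using opD[OF S] i by blast
      moreover obtain V' where "openin X V'" "x \<in> V'" "V' \<inter> U i \<subseteq> T"
        using opD[OF T] i by blast
      ultimately show ?thesis by (intro exI[of _ "V \<inter> V'"]) auto
    qed
    ultimately show "op (S \<inter> T)" using S by (auto simp: op_def)
  next
    fix \<K> assume K: "\<forall>K\<in>\<K>. op K"
    have "\<Union>\<K> \<inter> Y = \<Union>((\<lambda>K. K \<inter> Y) ` \<K>)" by auto
    moreover have "openin X (\<Union>((\<lambda>K. K \<inter> Y) ` \<K>))"
      using K by (intro openin_Union) (auto simp: op_def)
    ultimately have "openin X (\<Union>\<K> \<inter> Y)" by simp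
    moreover have "\<exists>V. openin X V \<and> x \<in> V \<and> V \<inter> U i \<subseteq> \<Union>\<K>"
      if i: "i \<in> I" "q i \<in> \<Union>\<K>" for i
    proof -
      obtain K' where "K' \<in> \<K>" "q i \<in> K'" using i by blast
      moreover from this obtain V where "openin X V" "x \<in> V" "V \<inter> U i \<subseteq> K'"
        using opD[of K' i] K i(1) by blast
      ultimately show ?thesis by blast
    qed
    moreover have "\<Union>\<K> \<subseteq> Y \<union> q ` I" using K unfolding op_def by blast
    ultimately show "op (\<Union>\<K>)" by (simp add: op_def)
  qed
  define Z where "Z = topology op"
  have op: "openin Z W \<longleftrightarrow> op W" for W
    by (simp add: Z_def topology_inverse'[OF \<open>istopology op\<close>])
  have opY: "openin Z W" if "openin X W" "W \<subseteq> Y" for W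
    using that qY by (auto simp: op op_def Int_absorb2)
  \<comment> \<open>These are the basic neighbourhoods of \<open>q i\<close>; injectivity of
    \<open>q\<close> makes the condition at every other copy vacuous.\<close>
  have opq: "openin Z (insert (q i) (V \<inter> U i))" if i: "i \<in> I" and V: "openin X V" "x \<in> V" for i V
  proof -
    have "insert (q i) (V \<inter> U i) \<inter> Y = V \<inter> U i"
      using i UY[OF i] qY[OF i] by auto
    moreover have "j = i" if "j \<in> I" "q j \<in> insert (q i) (V \<inter> U i)" for j
      using that i UY[OF i] qY[of j] inj_onD[OF q(1), of j i] by auto
    ultimately show ?thesis
      unfolding op op_def using i V U(1)[OF i] UY[OF i]
      by (auto intro!: openin_Int)
  qed
  have top: "topspace Z = Y \<union> q ` I"
  proof
    show "topspace Z \<subseteq> Y \<union> q ` I"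
      using openin_topspace[of Z] unfolding op op_def by blast
    show "Y \<union> q ` I \<subseteq> topspace Z"
      using opY[OF Yo] opq[OF _ openin_topspace x] openin_subset by fastforce
  qed
  have sub: "subtopology Z Y = subtopology X Y"
  proof (rule topology_eq[THEN iffD2], intro allI iffI)
    fix S assume "openin (subtopology Z Y) S"
    then obtain T where "openin Z T" "S = T \<inter> Y" by (auto simp: openin_subtopology)
    then show "openin (subtopology X Y) S"
      using Yo by (simp add: op op_def openin_open_subtopology)
  next
    fix S assume "openin (subtopology X Y) S"
    then have "openin X S" "S \<subseteq> Y" using Yo by (auto simp: openin_open_subtopology)
    then show "openin (subtopology Z Y) S"
      using opY[OF Yo] opY[of S] by (simp add: openin_open_subtopology)
  qed
  have dense: "Z closure_of Y = topspace Z"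
  proof (rule antisym[OF closure_of_subset_topspace], rule subsetI)
    fix z assume z: "z \<in> topspace Z"
    have "\<exists>y\<in>Y. y \<in> W" if W: "z \<in> W" "openin Z W" for W
    proof (cases "z \<in> Y")
      case False
      then obtain i where i: "i \<in> I" "z = q i" using z top by auto
      then obtain V where "openin X V" "x \<in> V" "V \<inter> U i \<subseteq> W"
        using opD[of W i] W op by blast
      \<comment> \<open>Accumulation of \<open>U i\<close> at \<open>x\<close> is what puts old
        points into every neighbourhood of \<open>q i\<close>.\<close>
      moreover from this obtain y where "y \<in> U i" "y \<in> V"
        using cl[OF i(1)] by (auto simp: in_closure_of)
      ultimately show ?thesis using UY[OF i(1)] by blast
    qed (use W in blast)
    then show "z \<in> Z closure_of Y" using z by (auto simp: in_closure_of)
  qed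
  \<comment> \<open>Separating \<open>y\<close> from \<open>x\<close> in \<open>X\<close> separates
    it from each copy: trace the neighbourhood of \<open>x\<close> on \<open>U i\<close>.\<close>
  have sepYq: "\<exists>S T. openin Z S \<and> openin Z T \<and> y \<in> S \<and> q i \<in> T \<and> disjnt S T"
    if y: "y \<in> Y" and i: "i \<in> I" for y i
  proof -
    have "y \<in> topspace X" "y \<noteq> x" using y by (auto simp: Y_def)
    then obtain S T where "openin X S" "openin X T" "y \<in> S" "x \<in> T" "disjnt S T"
      using X(2) x unfolding Hausdorff_space_def by blast
    then show ?thesis
      using opY[OF openin_Int[OF _ Yo], of S] opq[OF i, of T] y qY[OF i]
      by (intro exI[of _ "S \<inter> Y"] exI[of _ "insert (q i) (T \<inter> U i)"]) (auto simp: disjnt_iff)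
  qed
  have haus: "Hausdorff_space Z"
    unfolding Hausdorff_space_def
  proof (intro allI impI)
    fix a b assume "a \<in> topspace Z \<and> b \<in> topspace Z \<and> a \<noteq> b"
    then have ab: "a \<in> Y \<union> q ` I" "b \<in> Y \<union> q ` I" "a \<noteq> b" by (simp_all add: top)
    consider "a \<in> Y" "b \<in> Y" | i where "a \<in> Y" "i \<in> I" "b = q i"
      | i where "b \<in> Y" "i \<in> I" "a = q i" | i j where "i \<in> I" "j \<in> I" "a = q i" "b = q j"
      using ab by blast
    then show "\<exists>S T. openin Z S \<and> openin Z T \<and> a \<in> S \<and> b \<in> T \<and> disjnt S T"
    proof cases
      case 1
      then have "a \<in> topspace X" "b \<in> topspace X" by (auto simp: Y_def)
      then obtain S T where "openin X S" "openin X T" "a \<in> S" "b \<in> T" "disjnt S T"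
        using X(2) ab unfolding Hausdorff_space_def by blast
      then show ?thesis
        using opY[OF openin_Int[OF _ Yo]] 1
        by (intro exI[of _ "S \<inter> Y"] exI[of _ "T \<inter> Y"]) (auto simp: disjnt_iff)
    next
      case 2
      then show ?thesis using sepYq by blast
    next
      case 3
      then show ?thesis using sepYq[of b i] disjnt_sym by blast
    next
      case 4
      with ab have "i \<noteq> j" by metis
      then have "U i \<inter> U j = {}" using disjoint_family_onD[OF U(2) 4(1,2)] by simp
      then have "disjnt (insert (q i) (topspace X \<inter> U i)) (insert (q j) (topspace X \<inter> U j))"
        using 4 ab UY qY by (auto simp: disjnt_iff)
      with 4 show ?thesis using opq[OF _ openin_topspace x] by blast
    qed
  qed
  have comp: "compact_space Z"
    unfolding compact_space_alt
  proof (intro allI impI)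
    fix \<U> assume "(\<forall>W\<in>\<U>. openin Z W) \<and> topspace Z \<subseteq> \<Union>\<U>"
    then have op\<U>: "\<forall>W\<in>\<U>. openin Z W" and cov: "topspace Z \<subseteq> \<Union>\<U>" by simp_all
    have "\<forall>i\<in>I. \<exists>W. W \<in> \<U> \<and> q i \<in> W" using cov top by blast
    then obtain W where W: "\<And>i. i \<in> I \<Longrightarrow> W i \<in> \<U> \<and> q i \<in> W i" by metis
    then have "\<forall>i\<in>I. \<exists>V. openin X V \<and> x \<in> V \<and> V \<inter> U i \<subseteq> W i"
      using op\<U> op opD by blast
    then obtain V where V: "\<And>i. i \<in> I \<Longrightarrow> openin X (V i) \<and> x \<in> V i \<and> V i \<inter> U i \<subseteq> W i"
      by metis
    \<comment> \<open>A common neighbourhood of \<open>x\<close> for the chosen members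
      \<open>W i\<close>; the factor \<open>topspace X\<close> keeps it open even if
      \<open>I\<close> is empty.\<close>
    define N where "N = topspace X \<inter> (\<Inter>i\<in>I. V i)"
    have N: "openin X N" "x \<in> N"
      unfolding N_def using V x by (intro openin_Int_Inter finite_imageI I; auto) (use V x in auto)
    \<comment> \<open>Compactness of \<open>X\<close> is applied to the traces on \<open>Y\<close>,
      with \<open>N\<close> added to cover \<open>x\<close>. Afterwards \<open>N\<close> is replaced
      by the sets \<open>W i\<close>, since a point of \<open>N\<close> other than \<open>x\<close>
      lies in some \<open>U i\<close> and hence in \<open>W i\<close>.\<close>
    let ?\<C> = "insert N ((\<lambda>W. W \<inter> Y) ` \<U>)"
    have "\<forall>C\<in>?\<C>. openin X C" using N op\<U> by (auto simp: op op_def)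
    moreover have "topspace X \<subseteq> \<Union>?\<C>"
      using cov N top by (auto simp: Y_def)
    ultimately obtain \<F> where F: "finite \<F>" "\<F> \<subseteq> ?\<C>" "topspace X \<subseteq> \<Union>\<F>"
      using X(1) unfolding compact_space_alt by meson
    then have "finite (\<F> - {N})" "\<F> - {N} \<subseteq> (\<lambda>W. W \<inter> Y) ` \<U>" by auto
    then obtain \<G> where G: "finite \<G>" "\<G> \<subseteq> \<U>" "\<F> - {N} = (\<lambda>W. W \<inter> Y) ` \<G>"
      using finite_subset_image by metis
    have "topspace Z \<subseteq> \<Union>(\<G> \<union> W ` I)"
    proof
      fix z assume "z \<in> topspace Z"
      then consider "z \<in> N" "z \<in> Y" | "z \<in> Y" "z \<notin> N" | "z \<in> q ` I" using top by auto
      then show "z \<in> \<Union>(\<G> \<union> W ` I)"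
      proof cases
        case 1
        then obtain i where i: "i \<in> I" "z \<in> U i" using U(3) by (auto simp: Y_def)
        with 1 V[OF i(1)] have "z \<in> W i" by (auto simp: N_def)
        with i show ?thesis by blast
      next
        case 2
        then have "z \<in> \<Union>(\<F> - {N})" using F(3) by (auto simp: Y_def)
        then show ?thesis using G by auto
      next
        case 3
        then show ?thesis using W by auto
      qed
    qed
    then show "\<exists>\<F>. finite \<F> \<and> \<F> \<subseteq> \<U> \<and> topspace Z \<subseteq> \<Union>\<F>"
      using G I W by (intro exI[of _ "\<G> \<union> W ` I"]) auto
  qed
  have topY: "topspace (subtopology X Y) = Y" by (auto simp: Y_def)
  have diff: "topspace Z - Y = q ` I" using top qY by auto
  have "finite_compactification Z (subtopology X Y)"
    unfolding finite_compactification_def topY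
    using comp haus top sub dense diff I by auto
  with diff show thesis using that unfolding Y_def by blast
qed

section \<open>Nonprincipal ultrafilters\<close>

lemma topspace_omega_star:
  "topspace omega_star = {F. ultrafilter F \<and> F \<notin> omega_in_beta}"
  by (auto simp: omega_star_def topspace_beta_omega)

lemma Hausdorff_space_omega_star: "Hausdorff_space omega_star"
  unfolding omega_star_def by (intro Hausdorff_space_subtopology Hausdorff_space_beta_omega)

lemma compact_space_omega_star: "compact_space omega_star"
proof -
  have "openin beta_omega (\<Union>n. {principal {n}})"
    using openin_beta_omega_singleton by (intro openin_Union) auto
  moreover have "(\<Union>n. {principal {n}}) = omega_in_beta" by (auto simp: omega_in_beta_def)
  ultimately have "closedin beta_omega (topspace beta_omega - omega_in_beta)"
    by (simp add: closedin_diff)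
  then show ?thesis
    unfolding omega_star_def
    using compact_space_beta_omega closedin_compact_space compact_space_subtopology by blast
qed

lemma openin_omega_star_basic:
  "openin omega_star {F \<in> topspace omega_star. eventually P F}"
proof -
  have "{F \<in> topspace omega_star. eventually P F} =
      {F. ultrafilter F \<and> eventually P F} \<inter> (topspace beta_omega - omega_in_beta)"
    by (auto simp: topspace_omega_star topspace_beta_omega)
  then show ?thesis
    unfolding omega_star_def openin_subtopology using openin_beta_omega_basic by blast
qed

lemma openin_omega_starD:
  assumes "openin omega_star W" "F \<in> W"
  obtains A where "eventually (\<lambda>n. n \<in> A) F"
    "\<And>G. G \<in> topspace omega_star \<Longrightarrow> eventually (\<lambda>n. n \<in> A) G \<Longrightarrow> G \<in> W"
proof -
  obtain T where T: "openin beta_omega T" "W = T \<inter> (topspace beta_omega - omega_in_beta)"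
    using assms(1) by (auto simp: omega_star_def openin_subtopology)
  then obtain A where "eventually (\<lambda>n. n \<in> A) F"
    "{G. ultrafilter G \<and> eventually (\<lambda>n. n \<in> A) G} \<subseteq> T"
    using assms(2) unfolding openin_beta_omega by blast
  then show thesis
    using T(2) by (intro that[of A]) (auto simp: topspace_omega_star topspace_beta_omega)
qed

lemma ultrafilter_finite_disj:
  assumes "ultrafilter F" "finite I" "eventually (\<lambda>n. \<exists>i\<in>I. P i n) F"
  shows "\<exists>i\<in>I. eventually (P i) F"
proof (rule ccontr)
  assume "\<not> ?thesis"
  then have "eventually (\<lambda>n. \<forall>i\<in>I. \<not> P i n) F"
    using assms(1,2) by (auto simp: eventually_ball_finite_distrib ultrafilter_not)
  then have "\<not> eventually (\<lambda>n. \<exists>i\<in>I. P i n) F"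
    using ultrafilter_not[OF assms(1), of "\<lambda>n. \<exists>i\<in>I. P i n"] by simp
  with assms(3) show False by simp
qed

text \<open>An ultrafilter omitting a cofinite set contains the finite complement, hence a
  singleton, and so is principal. Conversely, a principal ultrafilter omits the cofinite complement
  of its point.\<close>

lemma omega_star_iff: "F \<in> topspace omega_star \<longleftrightarrow> ultrafilter F \<and> F \<le> cofinite"
proof -
  have "F \<le> cofinite" if F: "ultrafilter F" "F \<notin> omega_in_beta"
  proof (rule filter_leI)
    fix P :: "nat \<Rightarrow> bool" assume P: "eventually P cofinite"
    show "eventually P F"
    proof (rule ccontr)
      assume "\<not> eventually P F"
      then have "eventually (\<lambda>n. \<exists>k\<in>{k. \<not> P k}. n = k) F"
        using ultrafilter_not[OF F(1)] by simp
      then obtain k where k: "eventually (\<lambda>n. n = k) F"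
        using ultrafilter_finite_disj[OF F(1), of "{k. \<not> P k}" "\<lambda>k n. n = k"] P
        by (auto simp: eventually_cofinite)
      have "eventually Q F \<longleftrightarrow> Q k" for Q
      proof -
        have "eventually Q F \<longleftrightarrow> eventually (\<lambda>n. Q k) F"
          by (rule eventually_cong[OF k]) simp
        then show ?thesis using F(1) by (auto simp: ultrafilter_def eventually_const)
      qed
      then have "F = principal {k}" by (simp add: filter_eq_iff eventually_principal)
      with F(2) show False by (auto simp: omega_in_beta_def)
    qed
  qed
  moreover have "\<not> principal {n} \<le> cofinite" for n :: nat
  proof
    assume "principal {n} \<le> (cofinite :: nat filter)"
    moreover have "eventually (\<lambda>m. m \<noteq> n) cofinite" by (simp add: eventually_cofinite)
    ultimately have "eventually (\<lambda>m. m \<noteq> n) (principal {n})" by (rule filter_leD)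
    then show False by (simp add: eventually_principal)
  qed
  ultimately show ?thesis by (auto simp: topspace_omega_star omega_in_beta_def)
qed

lemma ultrafilter_frequently_infinite:
  assumes "F \<in> topspace omega_star" "eventually P F"
  shows "infinite {n. P n}"
proof
  assume "finite {n. P n}"
  then have "eventually (\<lambda>n. \<not> P n) F"
    using assms(1) by (auto simp: omega_star_iff eventually_cofinite intro: filter_leD)
  with assms show False by (simp add: omega_star_iff ultrafilter_not)
qed

text \<open>The cofinite filter restricted to an infinite set is still proper, and every ultrafilter
  refining it is nonprincipal.\<close>

lemma infinite_imp_in_omega_star:
  assumes "infinite {n::nat. P n}"
  obtains F where "F \<in> topspace omega_star" "eventually P F"
proof -
  have "inf cofinite (principal {n. P n}) \<noteq> bot"
    using assms by (simp add: trivial_limit_def eventually_inf_principal eventually_cofinite)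
  then obtain F where "ultrafilter F" "F \<le> inf cofinite (principal {n. P n})"
    by (rule ultrafilter_refines)
  then show thesis by (intro that[of F]) (auto simp: omega_star_iff le_principal)
qed

section \<open>Coherent partial colourings\<close>

text \<open>Nonprincipal ultrafilters ignore finite errors, so two compatible colourings cannot give
  the same one different colours.\<close>

definition compatible :: "('a \<rightharpoonup> 'b) \<Rightarrow> ('a \<rightharpoonup> 'b) \<Rightarrow> bool" where
  "compatible c d \<longleftrightarrow> finite {k \<in> dom c \<inter> dom d. c k \<noteq> d k}"

lemma compatible_sym: "compatible c d \<Longrightarrow> compatible d c"
  unfolding compatible_def by (simp add: Int_commute eq_commute)

lemma compatible_refl: "compatible c c"
  by (simp add: compatible_def)

text \<open>Being undefined \<open>x\<close>-almost everywhere keeps \<open>x\<close> out of every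
  piece, totality off \<open>A\<close> covers the ultrafilters not containing \<open>A\<close>, and
  the infinite colour classes inside \<open>A\<close> make each piece meet the neighbourhood of
  \<open>x\<close> given by \<open>A\<close>.\<close>

definition coloring_off :: "nat \<Rightarrow> nat filter \<Rightarrow> nat set \<Rightarrow> (nat \<rightharpoonup> nat) \<Rightarrow> bool" where
  "coloring_off N x A c \<longleftrightarrow> ran c \<subseteq> {..<N} \<and> eventually (\<lambda>k. k \<notin> dom c) x \<and>
     - A \<subseteq> dom c \<and> (\<forall>i<N. infinite {k \<in> A. c k = Some i})"

text \<open>Each finite stage \<open>B m\<close> belongs to \<open>x\<close> and is therefore
  infinite, so an increasing diagonal sequence exists. It is thinned to leave \<open>x\<close>,
  since colouring a member of \<open>x\<close> would give \<open>x\<close> a colour.\<close>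

lemma pseudo_intersection:
  fixes c :: "nat \<Rightarrow> nat \<rightharpoonup> 'b"
  assumes x: "x \<in> topspace omega_star" and A: "eventually (\<lambda>k. k \<in> A) x"
    and c: "\<And>m. eventually (\<lambda>k. k \<notin> dom (c m)) x"
  obtains e :: "nat \<Rightarrow> nat" where "strict_mono e" "range e \<subseteq> A"
    "\<And>l m. l \<le> m \<Longrightarrow> e m \<notin> dom (c l)" "eventually (\<lambda>k. k \<notin> range e) x"
proof -
  define B where "B m = {k \<in> A. \<forall>l\<le>m. k \<notin> dom (c l)}" for m
  have "infinite (B m)" for m
    unfolding B_def
  proof (rule ultrafilter_frequently_infinite[OF x])
    show "eventually (\<lambda>k. k \<in> A \<and> (\<forall>l\<le>m. k \<notin> dom (c l))) x"
      using A c eventually_ball_finite[of "{..m}" "\<lambda>k l. k \<notin> dom (c l)" x]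
      by (simp add: eventually_conj_iff Ball_def)
  qed
  then have "\<forall>m k. \<exists>k'. k' > k \<and> k' \<in> B m" unfolding infinite_nat_iff_unbounded by blast
  then have "\<exists>e. \<forall>m. e m \<in> B m \<and> e m < e (Suc m)"
    by (intro dependent_nat_choice) (blast, metis)
  then obtain e where e: "\<And>m. e m \<in> B m" "strict_mono e"
    by (auto simp: strict_mono_Suc_iff)
  \<comment> \<open>The even- and the odd-indexed terms cannot both form a member of the ultrafilter.\<close>
  have "\<exists>f::nat \<Rightarrow> nat. strict_mono f \<and> eventually (\<lambda>k. k \<notin> range (\<lambda>m. e (f m))) x"
  proof (rule ccontr)
    assume neg: "\<not> ?thesis"
    have ux: "ultrafilter x" using x by (simp add: omega_star_iff)
    have neg: "eventually (\<lambda>k. k \<in> range (\<lambda>m. e (f m))) x" if "strict_mono f" for f :: "nat \<Rightarrow> nat"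
      using neg ultrafilter_not[OF ux] that by blast
    have "eventually (\<lambda>k. k \<in> range (\<lambda>m. e (2 * m))) x"
      "eventually (\<lambda>k. k \<in> range (\<lambda>m. e (Suc (2 * m)))) x"
      by (rule neg; simp add: strict_mono_def)+
    then have "eventually (\<lambda>k. False) x"
    proof eventually_elim
      case (elim k)
      then obtain m m' where "e (2 * m) = e (Suc (2 * m'))" by auto
      then have "2 * m = Suc (2 * m')" using e(2) by (simp add: strict_mono_eq)
      then show False by presburger
    qed
    with ux show False by (simp add: ultrafilter_def eventually_False)
  qed
  then obtain f :: "nat \<Rightarrow> nat"
    where f: "strict_mono f" "eventually (\<lambda>k. k \<notin> range (\<lambda>m. e (f m))) x" by blast
  show thesis
  proof (rule that)
    show "strict_mono (\<lambda>m. e (f m))" using e(2) f(1) by (simp add: strict_mono_def)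
    show "range (\<lambda>m. e (f m)) \<subseteq> A" using e(1) by (auto simp: B_def)
    \<comment> \<open>Thinning preserves the diagonal property because
      \<open>m \<le> f m\<close>.\<close>
    show "e (f m) \<notin> dom (c l)" if "l \<le> m" for l m
      using e(1)[of "f m"] that seq_suble[OF f(1), of m] unfolding B_def by auto
  qed (rule f(2))
qed

text \<open>The successor and limit stages of the recursion at once: only countability of the set of
  earlier colourings matters.\<close>

lemma extend_colorings:
  assumes x: "x \<in> topspace omega_star" and A: "eventually (\<lambda>k. k \<in> A) x" and N: "N > 0"
    and C: "countable C"
    and col: "\<And>c. c \<in> C \<Longrightarrow> ran c \<subseteq> {..<N} \<and> eventually (\<lambda>k. k \<notin> dom c) x"
    and compat: "\<And>c d. c \<in> C \<Longrightarrow> d \<in> C \<Longrightarrow> compatible c d"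
  obtains d where "coloring_off N x A d" "\<And>c. c \<in> C \<Longrightarrow> compatible c d"
proof -
  \<comment> \<open>The empty colouring is compatible with everything; adding it makes the family
    nonempty and hence enumerable by the naturals.\<close>
  define C' where "C' = insert Map.empty C"
  define c where "c = from_nat_into C'"
  have rc: "range c = C'" unfolding c_def using C by (intro range_from_nat_into) (auto simp: C'_def)
  have cC: "c m \<in> C'" for m using rc by blast
  have cr: "ran (c m) \<subseteq> {..<N}" and cd: "eventually (\<lambda>k. k \<notin> dom (c m)) x" for m
    using cC[of m] col by (auto simp: C'_def)
  have cc: "compatible (c l) (c m)" for l m
    using cC[of m] cC[of l] compat by (auto simp: C'_def compatible_def)
  \<comment> \<open>The first colouring defined at \<open>k\<close> decides; the default colour 0 is
    legal because \<open>N > 0\<close>.\<close>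
  define g where
    "g k = (if \<exists>m. k \<in> dom (c m) then c (LEAST m. k \<in> dom (c m)) k else Some 0)" for k
  have gdom: "g k \<noteq> None" for k
    using LeastI_ex[of "\<lambda>m. k \<in> dom (c m)"] by (auto simp: g_def)
  have gran: "i < N" if "g k = Some i" for k i
    using that N cr by (auto simp: g_def ran_def subset_iff split: if_splits)
  \<comment> \<open>Where \<open>c m\<close> is defined, \<open>g\<close> copies some
    \<open>c l\<close> with \<open>l \<le> m\<close>, so only finitely many compatible pairs
    contribute errors.\<close>
  have gc: "finite {k \<in> dom (c m). c m k \<noteq> g k}" for m
  proof (rule finite_subset)
    show "{k \<in> dom (c m). c m k \<noteq> g k} \<subseteq>
        (\<Union>l\<in>{..m}. {k \<in> dom (c l) \<inter> dom (c m). c l k \<noteq> c m k})"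
    proof
      fix k assume k: "k \<in> {k \<in> dom (c m). c m k \<noteq> g k}"
      define l where "l = (LEAST m. k \<in> dom (c m))"
      have "k \<in> dom (c l)" "l \<le> m"
        using k LeastI[of "\<lambda>m. k \<in> dom (c m)" m] Least_le[of "\<lambda>m. k \<in> dom (c m)" m]
        unfolding l_def by auto
      moreover have "g k = c l k" using k unfolding g_def l_def by auto
      ultimately show "k \<in> (\<Union>l\<in>{..m}. {k \<in> dom (c l) \<inter> dom (c m). c l k \<noteq> c m k})"
        using k by (intro UN_I[of l]) auto
    qed
    show "finite (\<Union>l\<in>{..m}. {k \<in> dom (c l) \<inter> dom (c m). c l k \<noteq> c m k})"
      using cc by (simp add: compatible_def)
  qed
  obtain e where e: "strict_mono e" "range e \<subseteq> A" "\<And>l m. l \<le> m \<Longrightarrow> e m \<notin> dom (c l)"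
    "eventually (\<lambda>k. k \<notin> range e) x"
    using pseudo_intersection[of x A c, OF x A cd] by blast
  have inj: "inj e" using e(1) by (rule strict_mono_imp_inj_on)
  \<comment> \<open>Inside \<open>A\<close> only the thin sequence is coloured, cyclically modulo
    \<open>N\<close>: every colour recurs infinitely often, yet \<open>dom d\<close> stays outside
    \<open>x\<close>.\<close>
  define d where
    "d k = (if k \<notin> A then g k else if k \<in> range e then Some (inv e k mod N) else None)" for k
  have de: "d (e m) = Some (m mod N)" for m
    using e(2) inj by (auto simp: d_def)
  show thesis
  proof (rule that)
    have "ran d \<subseteq> {..<N}" using gran N by (auto simp: ran_def d_def split: if_splits)
    moreover have "eventually (\<lambda>k. k \<notin> dom d) x"
      using A e(4) by eventually_elim (auto simp: d_def)
    moreover have "- A \<subseteq> dom d" using gdom by (auto simp: d_def)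
    moreover have "infinite {k \<in> A. d k = Some i}" if "i < N" for i
    proof (rule infinite_super)
      show "range (\<lambda>m. e (m * N + i)) \<subseteq> {k \<in> A. d k = Some i}"
        using e(2) that by (auto simp: de)
      have "inj (\<lambda>m. e (m * N + i))" using N by (auto simp: inj_def dest: injD[OF inj])
      then show "infinite (range (\<lambda>m. e (m * N + i)))" by (rule range_inj_infinite)
    qed
    ultimately show "coloring_off N x A d" by (simp add: coloring_off_def)
  next
    fix c' assume "c' \<in> C"
    then obtain m where m: "c' = c m" using rc by (auto simp: C'_def)
    \<comment> \<open>Off \<open>A\<close> the errors are those of \<open>g\<close>; inside
      \<open>A\<close> only the terms \<open>e j\<close> with \<open>j < m\<close> can lie in
      \<open>dom (c m)\<close>.\<close>
    have "{k \<in> dom c' \<inter> dom d. c' k \<noteq> d k} \<subseteq> {k \<in> dom (c m). c m k \<noteq> g k} \<union> e ` {..<m}"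
    proof
      fix k assume k: "k \<in> {k \<in> dom c' \<inter> dom d. c' k \<noteq> d k}"
      show "k \<in> {k \<in> dom (c m). c m k \<noteq> g k} \<union> e ` {..<m}"
      proof (cases "k \<in> A")
        case True
        with k obtain j where "k = e j" by (auto simp: d_def split: if_splits)
        moreover from this k e(3)[of m j] have "j < m" by (force simp: m)
        ultimately show ?thesis by blast
      qed (use k in \<open>auto simp: d_def m\<close>)
    qed
    then show "compatible c' d"
      unfolding compatible_def by (rule finite_subset) (simp add: gc)
  qed
qed

section \<open>Transfinite recursion under CH\<close>

text \<open>Proper initial segments of a cardinal order have strictly smaller cardinality; below the
  successor of \<open>natLeq\<close> this means countable. Removing \<open>Id\<close> makes the
  order strict.\<close>

lemma continuum_hypothesis_wellorder:
  assumes continuum_hypothesis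
  obtains R :: "nat set rel" where "wf R" "\<And>A. countable {B. (B, A) \<in> R}"
    "\<And>A B. A \<noteq> B \<Longrightarrow> (A, B) \<in> R \<or> (B, A) \<in> R"
proof
  let ?r = "|UNIV :: nat set set|"
  have wo: "Well_order ?r" by (rule card_of_Well_order)
  then show "wf (?r - Id)" by (simp add: well_order_on_def)
  show "(A, B) \<in> ?r - Id \<or> (B, A) \<in> ?r - Id" if "A \<noteq> B" for A B
    using wo that by (auto simp: well_order_on_def linear_order_on_def total_on_def Field_card_of)
  show "countable {B. (B, A) \<in> ?r - Id}" for A
  proof -
    have "|underS ?r A| <o ?r"
      by (rule card_of_underS[OF card_of_Card_order]) (simp add: Field_card_of)
    also have "?r =o cardSuc natLeq" using assms by (simp add: continuum_hypothesis_def)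
    finally have "|underS ?r A| \<le>o natLeq"
      using cardSuc_ordLeq_ordLess[OF natLeq_Card_order card_of_Card_order] by blast
    then have "countable (underS ?r A)"
      by (simp add: countable_card_le_natLeq)
    moreover have "underS ?r A = {B. (B, A) \<in> ?r - Id}" by (auto simp: underS_def)
    ultimately show ?thesis by simp
  qed
qed

lemma coherent_colorings:
  assumes ch: continuum_hypothesis and x: "x \<in> topspace omega_star" and N: "N > 0"
  obtains c where "\<And>A. eventually (\<lambda>k. k \<in> A) x \<Longrightarrow> coloring_off N x A (c A)"
    "\<And>A B. eventually (\<lambda>k. k \<in> A) x \<Longrightarrow> eventually (\<lambda>k. k \<in> B) x \<Longrightarrow> compatible (c A) (c B)"
proof -
  obtain R :: "nat set rel" where R: "wf R" "\<And>A. countable {B. (B, A) \<in> R}"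
    "\<And>A B. A \<noteq> B \<Longrightarrow> (A, B) \<in> R \<or> (B, A) \<in> R"
    using continuum_hypothesis_wellorder[OF ch] by blast
  \<comment> \<open>Compatibility is demanded only with predecessors of \<open>A\<close>, so
    \<open>P\<close> suits recursion along \<open>R\<close>; totality of \<open>R\<close> and
    symmetry later give it for all pairs.\<close>
  define P where "P c A d \<longleftrightarrow> (eventually (\<lambda>k. k \<in> A) x \<longrightarrow> coloring_off N x A d \<and>
      (\<forall>B. (B, A) \<in> R \<longrightarrow> eventually (\<lambda>k. k \<in> B) x \<longrightarrow> compatible (c B) d))" for c A d
  have "\<exists>c. \<forall>A. P c A (c A)"
  proof (rule dependent_wf_choice[OF R(1)])
    show "P f A d = P g A d" if "\<And>B. (B, A) \<in> R \<Longrightarrow> f B = g B" for f g A d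
      using that by (auto simp: P_def)
    fix A c assume IH: "\<And>B. (B, A) \<in> R \<Longrightarrow> P c B (c B)"
    show "\<exists>d. P c A d"
    proof (cases "eventually (\<lambda>k. k \<in> A) x")
      case True
      let ?S = "{B. (B, A) \<in> R \<and> eventually (\<lambda>k. k \<in> B) x}"
      have "countable (c ` ?S)"
        by (intro countable_image countable_subset[OF _ R(2)[of A]]) auto
      \<comment> \<open>Two distinct predecessors are comparable in \<open>R\<close>, so the
        induction hypothesis at the later one applies.\<close>
      moreover have "compatible d d'" if "d \<in> c ` ?S" "d' \<in> c ` ?S" for d d'
      proof -
        from that obtain B B' where B: "B \<in> ?S" "d = c B" "B' \<in> ?S" "d' = c B'" by blast
        with IH[of B] IH[of B'] R(3)[of B B'] show ?thesis
          by (cases "B = B'") (auto simp: P_def compatible_refl intro: compatible_sym)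
      qed
      moreover have "ran d \<subseteq> {..<N} \<and> eventually (\<lambda>k. k \<notin> dom d) x" if "d \<in> c ` ?S" for d
      proof -
        from that obtain B where "B \<in> ?S" "d = c B" by blast
        with IH[of B] show ?thesis by (simp add: P_def coloring_off_def)
      qed
      ultimately obtain d where "coloring_off N x A d" "\<And>c'. c' \<in> c ` ?S \<Longrightarrow> compatible c' d"
        using extend_colorings[OF x True N, of "c ` ?S"] by blast
      then show ?thesis by (auto simp: P_def)
    qed (simp add: P_def)
  qed
  then obtain c where c: "\<And>A. P c A (c A)" by blast
  show thesis
  proof (rule that)
    show "coloring_off N x A (c A)" if "eventually (\<lambda>k. k \<in> A) x" for A
      using c[of A] that by (simp add: P_def)
    show "compatible (c A) (c B)"
      if "eventually (\<lambda>k. k \<in> A) x" "eventually (\<lambda>k. k \<in> B) x" for A B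
      using c[of A] c[of B] R(3)[of A B] that
      by (cases "A = B") (auto simp: P_def compatible_refl intro: compatible_sym)
  qed
qed

section \<open>From colourings to open pieces accumulating at the point\<close>

lemma omega_star_split_point:
  assumes ch: continuum_hypothesis and x: "x \<in> topspace omega_star" and N: "N > 0"
  obtains U :: "nat \<Rightarrow> nat filter set"
  where "\<And>i. i < N \<Longrightarrow> openin omega_star (U i)" "disjoint_family_on U {..<N}"
    "(\<Union>i<N. U i) = topspace omega_star - {x}" "\<And>i. i < N \<Longrightarrow> x \<in> omega_star closure_of U i"
proof -
  obtain c where c: "\<And>A. eventually (\<lambda>k. k \<in> A) x \<Longrightarrow> coloring_off N x A (c A)"
    "\<And>A B. eventually (\<lambda>k. k \<in> A) x \<Longrightarrow> eventually (\<lambda>k. k \<in> B) x \<Longrightarrow> compatible (c A) (c B)"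
    using coherent_colorings[OF ch x N] by blast
  define V where "V A i = {F \<in> topspace omega_star. eventually (\<lambda>k. c A k = Some i) F}" for A i
  \<comment> \<open>\<open>U i\<close> collects the ultrafilters that receive colour
    \<open>i\<close> from at least one of the colourings.\<close>
  define U where "U i = (\<Union>A\<in>{A. eventually (\<lambda>k. k \<in> A) x}. V A i)" for i
  have ux: "ultrafilter x" using x by (simp add: omega_star_iff)
  have Vx: "x \<notin> V A i" if "eventually (\<lambda>k. k \<in> A) x" for A i
  proof
    assume "x \<in> V A i"
    then have "eventually (\<lambda>k. c A k = Some i) x" by (simp add: V_def)
    moreover have "eventually (\<lambda>k. k \<notin> dom (c A)) x"
      using c(1)[OF that] by (simp add: coloring_off_def)
    ultimately have "eventually (\<lambda>k. False) x" by eventually_elim auto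
    with ux show False by (simp add: ultrafilter_def eventually_False)
  qed
  show thesis
  proof (rule that)
    show "openin omega_star (U i)" for i
      unfolding U_def V_def by (intro openin_Union) (auto intro: openin_omega_star_basic)
    show "disjoint_family_on U {..<N}"
    proof (clarsimp simp: disjoint_family_on_def, rule ccontr)
      fix i j assume ij: "i \<noteq> j" "U i \<inter> U j \<noteq> {}"
      then obtain F A B where AB: "eventually (\<lambda>k. k \<in> A) x" "eventually (\<lambda>k. k \<in> B) x"
        and F: "F \<in> V A i" "F \<in> V B j" by (auto simp: U_def)
      then have "eventually (\<lambda>k. c A k = Some i \<and> c B k = Some j) F" and "F \<in> topspace omega_star"
        by (auto simp: V_def eventually_conj_iff)
      \<comment> \<open>A common member of two pieces would contain the disagreement set of
        \<open>c A\<close> and \<open>c B\<close>, which is finite.\<close>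
      then have "infinite {k. c A k = Some i \<and> c B k = Some j}"
        by (intro ultrafilter_frequently_infinite)
      moreover have "{k. c A k = Some i \<and> c B k = Some j} \<subseteq>
          {k \<in> dom (c A) \<inter> dom (c B). c A k \<noteq> c B k}" using ij by auto
      ultimately show False using c(2)[OF AB] finite_subset unfolding compatible_def by blast
    qed
    show "(\<Union>i<N. U i) = topspace omega_star - {x}"
    proof
      show "(\<Union>i<N. U i) \<subseteq> topspace omega_star - {x}"
        using Vx by (auto simp: U_def V_def)
      show "topspace omega_star - {x} \<subseteq> (\<Union>i<N. U i)"
      proof
        fix F assume F: "F \<in> topspace omega_star - {x}"
        then have uF: "ultrafilter F" and "F \<noteq> x" by (auto simp: omega_star_iff)
        then have "\<not> x \<le> F \<or> \<not> F \<le> x" by auto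
        \<comment> \<open>Replacing a separating predicate by its negation if necessary,
          \<open>Q\<close> belongs to \<open>x\<close> and its complement to \<open>F\<close>. The
          colouring for \<open>Q\<close> is total on that complement, so \<open>F\<close> selects
          one of the finitely many colours.\<close>
        then obtain Q where Q: "eventually Q x" "\<not> eventually Q F"
          using ultrafilter_not[OF uF] ultrafilter_not[OF ux] unfolding le_filter_def by metis
        have A: "eventually (\<lambda>k. k \<in> {k. Q k}) x" using Q by simp
        let ?c = "c {k. Q k}"
        have "eventually (\<lambda>k. \<not> Q k) F" using Q uF by (simp add: ultrafilter_not)
        then have "eventually (\<lambda>k. \<exists>i\<in>{..<N}. ?c k = Some i) F"
        proof eventually_elim
          case (elim k)
          then obtain i where "?c k = Some i"
            using c(1)[OF A] by (auto simp: coloring_off_def)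
          moreover from this have "i < N"
            using c(1)[OF A] by (auto simp: coloring_off_def ran_def)
          ultimately show ?case by auto
        qed
        then obtain i where "i < N" "eventually (\<lambda>k. ?c k = Some i) F"
          using ultrafilter_finite_disj[OF uF, of "{..<N}" "\<lambda>i k. ?c k = Some i"] by auto
        with F have "F \<in> V {k. Q k} i" by (simp add: V_def)
          with A \<open>i < N\<close> show "F \<in> (\<Union>i<N. U i)" unfolding U_def by blast
      qed
    qed
    show "x \<in> omega_star closure_of U i" if i: "i < N" for i
      unfolding in_closure_of
    proof (intro conjI allI impI x)
      fix T assume "x \<in> T \<and> openin omega_star T"
      then obtain A where A: "eventually (\<lambda>n. n \<in> A) x"
        and AT: "\<And>G. G \<in> topspace omega_star \<Longrightarrow> eventually (\<lambda>n. n \<in> A) G \<Longrightarrow> G \<in> T"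
        using openin_omega_starD by blast
      \<comment> \<open>The basic neighbourhood given by \<open>A\<close> is met through
        \<open>c A\<close> itself, whose colour classes inside \<open>A\<close> are
        infinite.\<close>
      have "infinite {k. k \<in> A \<and> c A k = Some i}"
        using c(1)[OF A] i by (simp add: coloring_off_def)
      then obtain F where "F \<in> topspace omega_star" "eventually (\<lambda>k. k \<in> A \<and> c A k = Some i) F"
        by (rule infinite_imp_in_omega_star)
      then show "\<exists>F. F \<in> U i \<and> F \<in> T"
        using A AT by (auto simp: eventually_conj_iff U_def V_def intro!: exI[of _ F])
    qed
  qed
qed

theorem mainTheorem3:
  fixes x :: "nat filter"
  assumes "continuum_hypothesis"
    and "x \<in> topspace omega_star"
  shows "\<forall>n::nat. \<exists>Z :: nat filter topology.
           finite_compactification Z (subtopology omega_star (topspace omega_star - {x})) \<and>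
           n \<le> card (topspace Z - (topspace omega_star - {x}))"
proof
  fix n :: nat
  \<comment> \<open>Principal ultrafilters have the right type and lie outside
    \<open>omega_star\<close>, so they can name the new points. Using \<open>Suc n\<close> of them
    ensures a positive number of colours even for \<open>n = 0\<close>.\<close>
  let ?q = "\<lambda>i. principal {i} :: nat filter"
  obtain U where U: "\<And>i. i < Suc n \<Longrightarrow> openin omega_star (U i)" "disjoint_family_on U {..<Suc n}"
    "(\<Union>i<Suc n. U i) = topspace omega_star - {x}"
    "\<And>i. i < Suc n \<Longrightarrow> x \<in> omega_star closure_of U i"
    using omega_star_split_point[OF assms, of "Suc n"] by blast
  have q: "inj_on ?q {..<Suc n}"
    by (auto simp: inj_on_def)
  have q': "?q i \<notin> topspace omega_star" for i
    by (simp add: topspace_omega_star omega_in_beta_def)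
  obtain Z where Z: "finite_compactification Z (subtopology omega_star (topspace omega_star - {x}))"
    "topspace Z - (topspace omega_star - {x}) = ?q ` {..<Suc n}"
    using finite_compactification_split_point[OF compact_space_omega_star
        Hausdorff_space_omega_star assms(2) finite_lessThan q q' U(1,2,3,4)] by auto
  have "n \<le> card (?q ` {..<Suc n})" using q by (simp add: card_image)
  with Z show "\<exists>Z. finite_compactification Z (subtopology omega_star (topspace omega_star - {x})) \<and>
      n \<le> card (topspace Z - (topspace omega_star - {x}))" by metis
qed

end
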